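(* For $n\ge 2$ let $s_n=|S_n(132,213)|$ be the number of permutations of $\{1,\dots,n\}$ that simultaneously avoid the contiguous patterns $132$ and $213$, and for $1\le i,j\le n$ let $s(n;i,j)$ be the number of those permutations $\pi=\pi_1\cdots\pi_n$ with $\pi_1=i$ and $\pi_2=j$. Then $s_n=\sum_{i,j=1}^n s(n;i,j)$, where the numbers $s(n;i,j)$ satisfy: - $s(n;i,i)=0$ for all $n\ge 2$ and $1\le i\le n$; - for $n\ge 3$ and $1\le j<i\le n$, $\displaystyle s(n;i,j)=\sum_{k=1}^{i-1} s(n-1;j,k)$; - for $n\ge 3$ and $1\le i<j\le n$, $\displaystyle s(n;i,j)=\sum_{k=1}^{i-1}s(n-1;j-1,k)+\sum_{k=j}^{n-1}s(n-1;j-1,k)$; - $s(2;1,2)=s(2;2,1)=1$ and $s(2;1,1)=s(2;2,2)=0$.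
   Context: Permutations of $\{1,\dots,n\}$ are written as words $\pi=\pi_1\pi_2\cdots\pi_n$. A pattern with no dashes, such as $132$ or $213$, is a contiguous pattern: $\pi$ contains it if some three consecutive letters $\pi_a\pi_{a+1}\pi_{a+2}$ are order-isomorphic to it, and $\pi$ avoids it otherwise. $S_n(132,213)$ is the set of permutations of $\{1,\dots,n\}$ avoiding both contiguous patterns. Empty sums are $0$. *)

theory Defs
  imports "HOL-Combinatorics.Multiset_Permutations" "HOL-Library.Sublist"
begin

(* Permutations of {1..n} are words in one-line notation, i.e. the lists in
   permutations_of_set {1..n}; the letter \<pi>_a is w ! (a - 1). *)

definition order_isomorphic :: "nat list \<Rightarrow> nat list \<Rightarrow> bool" where
  "order_isomorphic u v \<longleftrightarrow> length u = length v \<and>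
     (\<forall>a < length u. \<forall>b < length u. u ! a < u ! b \<longleftrightarrow> v ! a < v ! b)"

(* sublist is the contiguous-factor relation of HOL-Library (subseq would be the
   non-contiguous one). *)

definition contains_pattern :: "nat list \<Rightarrow> nat list \<Rightarrow> bool" where
  "contains_pattern w p \<longleftrightarrow> (\<exists>u. sublist u w \<and> order_isomorphic u p)"

definition avoiders :: "nat \<Rightarrow> nat list set" where
  "avoiders n = {w \<in> permutations_of_set {1..n}.
     \<not> contains_pattern w [1, 3, 2] \<and> \<not> contains_pattern w [2, 1, 3]}"

definition num_avoiders :: "nat \<Rightarrow> nat" where
  "num_avoiders n = card (avoiders n)"

(* Only meaningful for n \<ge> 2, where the first two letters exist. *)

definition num_avoiders_start :: "nat \<Rightarrow> nat \<Rightarrow> nat \<Rightarrow> nat" where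
  "num_avoiders_start n i j = card {w \<in> avoiders n. w ! 0 = i \<and> w ! 1 = j}"

end

theory Submission
  imports Defs
begin

text \<open>
  The recurrences come from removing the first letter \<open>i\<close> of a permutation of \<open>{1..m + 1}\<close> and
  closing the gap that it leaves among the values. The inverse operation, \<open>prepend\<close>, relabels
  the letters of a permutation of \<open>{1..m}\<close> by the increasing map \<open>skip i\<close>, whose range misses
  exactly \<open>i\<close>, and puts \<open>i\<close> in front; it is a bijection onto the permutations of
  \<open>{1..m + 1}\<close> that start with \<open>i\<close>. An increasing relabelling does not change which contiguous
  patterns occur, so the only new occurrence that \<open>prepend\<close> can create is one at the first three
  letters. If the shorter word starts with \<open>a\<close>, \<open>b\<close>, these letters are \<open>i\<close>, \<open>skip i a\<close>,
  \<open>skip i b\<close>, and they form neither 132 nor 213 exactly when \<open>b < i\<close> or \<open>i \<le> a < b\<close>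
  (\<open>prepend_in_avoiders_iff\<close>). Summing over the admissible \<open>b\<close> gives one recurrence
  (\<open>num_avoiders_start_recurrence\<close>). The two recurrences of the theorem are its cases
  \<open>a < i\<close>, where the second letter is \<open>j = a\<close>, and \<open>a \<ge> i\<close>, where it is \<open>j = a + 1\<close>.
\<close>

section \<open>Contiguous patterns\<close>

text \<open>An occurrence either starts at the first letter, and then its length determines it,
  or it lies in the tail. For a word shorter than the pattern the first disjunct is false because
  order-isomorphic words have equal length.\<close>

lemma contains_pattern_Cons:
  "contains_pattern (x # w) p \<longleftrightarrow>
     order_isomorphic (take (length p) (x # w)) p \<or> contains_pattern w p"
proof -
  have "(\<exists>u. prefix u (x # w) \<and> order_isomorphic u p) \<longleftrightarrow>
        order_isomorphic (take (length p) (x # w)) p" (is "?L \<longleftrightarrow> ?R")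
  proof
    assume ?L
    then obtain u where u: "prefix u (x # w)" "order_isomorphic u p" by blast
    then have "length u = length p" by (simp add: order_isomorphic_def)
    with u(1) have "u = take (length p) (x # w)"
      by (metis append_eq_conv_conj prefix_def)
    with u(2) show ?R by simp
  next
    assume ?R
    then show ?L using take_is_prefix by blast
  qed
  then show ?thesis
    unfolding contains_pattern_def sublist_Cons_right by blast
qed

lemma order_isomorphic_map:
  assumes "strict_mono f"
  shows "order_isomorphic (map f u) p \<longleftrightarrow> order_isomorphic u p"
  using strict_mono_less[OF assms] by (auto simp: order_isomorphic_def)

lemma contains_pattern_map:
  assumes "strict_mono f"
  shows "contains_pattern (map f w) p \<longleftrightarrow> contains_pattern w p"
proof (induction w)
  case (Cons x w)
  have "take (length p) (map f (x # w)) = map f (take (length p) (x # w))"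
    by (rule take_map)
  then show ?case
    using Cons.IH order_isomorphic_map[OF assms] by (simp add: contains_pattern_Cons)
qed simp

lemma order_isomorphic_132:
  "order_isomorphic [x, y, z] [1, 3, 2] \<longleftrightarrow> x < z \<and> z < y"
  by (auto simp: order_isomorphic_def All_less_Suc numeral_3_eq_3)

lemma order_isomorphic_213:
  "order_isomorphic [x, y, z] [2, 1, 3] \<longleftrightarrow> y < x \<and> x < z"
  by (auto simp: order_isomorphic_def All_less_Suc numeral_3_eq_3)

section \<open>Prepending a letter\<close>

definition skip :: "nat \<Rightarrow> nat \<Rightarrow> nat" where
  "skip i x = (if x < i then x else Suc x)"

definition prepend :: "nat \<Rightarrow> nat list \<Rightarrow> nat list" where
  "prepend i v = i # map (skip i) v"

lemma strict_mono_skip: "strict_mono (skip i)"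
  by (auto simp: strict_mono_def skip_def)

lemma inj_skip: "inj (skip i)"
  by (rule strict_mono_imp_inj_on[OF strict_mono_skip])

lemma inj_prepend: "inj (prepend i)"
  using inj_skip by (simp add: prepend_def inj_def[of "prepend i"] inj_map_eq_map)

lemma skip_image:
  assumes "i \<in> {1..Suc m}"
  shows "skip i ` {1..m} = {1..Suc m} - {i}"
proof (intro equalityI subsetI)
  fix y assume "y \<in> {1..Suc m} - {i}"
  then have "y = skip i (if y < i then y else y - 1)" "(if y < i then y else y - 1) \<in> {1..m}"
    using assms by (auto simp: skip_def)
  then show "y \<in> skip i ` {1..m}" by blast
qed (use assms in \<open>auto simp: skip_def split: if_splits\<close>)

lemma permutations_starting_with:
  assumes "i \<in> {1..Suc m}"
  shows "{w \<in> permutations_of_set {1..Suc m}. w ! 0 = i} = prepend i ` permutations_of_set {1..m}"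
proof -
  have "{w \<in> permutations_of_set {1..Suc m}. w ! 0 = i} =
        (#) i ` permutations_of_set ({1..Suc m} - {i})"
    using assms by (subst permutations_of_set_nonempty) auto
  also have "permutations_of_set ({1..Suc m} - {i}) = map (skip i) ` permutations_of_set {1..m}"
    unfolding skip_image[OF assms, symmetric]
    by (intro permutations_of_set_image_inj inj_on_subset[OF inj_skip] subset_UNIV)
  finally show ?thesis
    by (simp add: image_image prepend_def )
qed

section \<open>Avoiders of 132 and 213\<close>

lemma avoiders_imp_permutation: "w \<in> avoiders n \<Longrightarrow> w \<in> permutations_of_set {1..n}"
  by (simp add: avoiders_def)

lemma finite_avoiders: "finite (avoiders n)"
  by (simp add: avoiders_def)

lemma first_letters:
  assumes "w \<in> permutations_of_set {1..n}" "n \<ge> (2 :: nat)"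
  obtains a b r where "w = a # b # r" "a \<in> {1..n}" "b \<in> {1..n}" "a \<noteq> b"
proof -
  from assms have "length w \<ge> 2"
    using length_finite_permutations_of_set[OF assms(1)] by simp
  then obtain a b r where "w = a # b # r"
    by (metis Suc_le_length_iff numeral_2_eq_2)
  moreover have "set w = {1..n}" "distinct w"
    using assms(1) by (auto dest: permutations_of_setD)
  ultimately show thesis by (intro that[of a b r]) auto
qed

text \<open>The relabelled letters satisfy \<open>skip i x < i\<close> iff \<open>x < i\<close>. The word
  \<open>i\<close>, \<open>skip i a\<close>, \<open>skip i b\<close> is therefore a 132 iff \<open>i \<le> b < a\<close>, and a 213
  iff \<open>a < i \<le> b\<close>. Together these cases exhaust \<open>i \<le> b\<close> except for
  \<open>i \<le> a < b\<close>, because \<open>a \<noteq> b\<close>.\<close>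

lemma prepend_in_avoiders_iff:
  assumes v: "v \<in> permutations_of_set {1..m}" and m: "m \<ge> 2" and i: "i \<in> {1..Suc m}"
  shows "prepend i v \<in> avoiders (Suc m) \<longleftrightarrow>
           v \<in> avoiders m \<and> (v ! 1 < i \<or> i \<le> v ! 0 \<and> v ! 0 < v ! 1)"
proof -
  obtain a b r where ab: "v = a # b # r" "a \<noteq> b"
    using first_letters[OF v m] by metis
  have contains: "contains_pattern (prepend i v) p \<longleftrightarrow>
      order_isomorphic [i, skip i a, skip i b] p \<or> contains_pattern v p" if "length p = 3" for p
    using contains_pattern_map[OF strict_mono_skip, of i v p] that
    by (simp add: prepend_def contains_pattern_Cons[of i] ab(1) numeral_3_eq_3)
  have "prepend i v \<in> permutations_of_set {1..Suc m}"
    using permutations_starting_with[OF i] v by blast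
  then show ?thesis
    using v contains[of "[1, 3, 2]"] contains[of "[2, 1, 3]"] ab(2)
    unfolding avoiders_def order_isomorphic_132 order_isomorphic_213
    by (auto simp: ab(1) skip_def split: if_splits)
qed

text \<open>Since \<open>skip i\<close> is injective, the second letter of \<open>prepend i v\<close> is \<open>skip i a\<close>
  exactly when \<open>v\<close> starts with \<open>a\<close>; the index \<open>k\<close> is the second letter of \<open>v\<close>. If \<open>a < i\<close>,
  the sum has a term for \<open>k = a\<close>, but it is zero.\<close>

lemma num_avoiders_start_recurrence:
  assumes m: "m \<ge> 2" and i: "i \<in> {1..Suc m}"
  shows "num_avoiders_start (Suc m) i (skip i a) =
           (\<Sum>k \<in> {k \<in> {1..m}. k < i \<or> i \<le> a \<and> a < k}. num_avoiders_start m a k)"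
    (is "_ = sum _ ?K")
proof -
  have "{w \<in> avoiders (Suc m). w ! 0 = i \<and> w ! 1 = skip i a} =
        {w \<in> prepend i ` permutations_of_set {1..m}. w \<in> avoiders (Suc m) \<and> w ! 1 = skip i a}"
    unfolding permutations_starting_with[OF i, symmetric]
    by (auto dest: avoiders_imp_permutation)
  also have "\<dots> = prepend i ` {v \<in> permutations_of_set {1..m}.
                     prepend i v \<in> avoiders (Suc m) \<and> prepend i v ! 1 = skip i a}"
    by blast
  also have "{v \<in> permutations_of_set {1..m}.
                prepend i v \<in> avoiders (Suc m) \<and> prepend i v ! 1 = skip i a} =
             (\<Union>k \<in> ?K. {v \<in> avoiders m. v ! 0 = a \<and> v ! 1 = k})" (is "?A = ?B")
  proof (intro set_eqI)
    fix v
    show "v \<in> ?A \<longleftrightarrow> v \<in> ?B"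
    proof (cases "v \<in> permutations_of_set {1..m}")
      case True
      obtain x y r where xy: "v = x # y # r" "y \<in> {1..m}"
        using first_letters[OF True m] by metis
      have "prepend i v ! 1 = skip i a \<longleftrightarrow> x = a"
        using strict_mono_eq[OF strict_mono_skip] by (simp add: prepend_def xy(1))
      with True xy prepend_in_avoiders_iff[OF True m i] show ?thesis
        by simp blast
    qed (auto dest: avoiders_imp_permutation)
  qed
  finally have "num_avoiders_start (Suc m) i (skip i a) = card ?B"
    by (simp add: num_avoiders_start_def card_image inj_on_subset[OF inj_prepend])
  also have "\<dots> = (\<Sum>k \<in> ?K. num_avoiders_start m a k)"
    unfolding num_avoiders_start_def
    by (rule card_UN_disjoint) (auto simp: finite_avoiders)
  finally show ?thesis .
qed

lemma num_avoiders_eq_sum: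
  assumes "n \<ge> 2"
  shows "num_avoiders n = (\<Sum>i=1..n. \<Sum>j=1..n. num_avoiders_start n i j)"
proof -
  have "avoiders n = (\<Union>i\<in>{1..n}. \<Union>j\<in>{1..n}. {w \<in> avoiders n. w ! 0 = i \<and> w ! 1 = j})"
    (is "_ = (\<Union>i\<in>_. ?U i)")
  proof (intro equalityI subsetI)
    fix w assume w: "w \<in> avoiders n"
    obtain a b r where "w = a # b # r" "a \<in> {1..n}" "b \<in> {1..n}"
      using first_letters[OF avoiders_imp_permutation[OF w] assms] by metis
    with w show "w \<in> (\<Union>i\<in>{1..n}. ?U i)" by simp
  qed blast
  then have "num_avoiders n = card (\<Union>i\<in>{1..n}. ?U i)"
    by (simp add: num_avoiders_def)
  also have "\<dots> = (\<Sum>i=1..n. card (?U i))"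
    by (rule card_UN_disjoint) (auto simp: finite_avoiders)
  also have "\<dots> = (\<Sum>i=1..n. \<Sum>j=1..n. num_avoiders_start n i j)"
    unfolding num_avoiders_start_def
    by (intro sum.cong refl card_UN_disjoint) (auto simp: finite_avoiders)
  finally show ?thesis .
qed

lemma num_avoiders_start_diagonal:
  assumes "n \<ge> 2"
  shows "num_avoiders_start n i i = 0"
proof -
  have "\<not> (w ! 0 = i \<and> w ! 1 = i)" if "w \<in> avoiders n" for w
    using first_letters[OF avoiders_imp_permutation[OF that] assms] by fastforce
  then have "{w \<in> avoiders n. w ! 0 = i \<and> w ! 1 = i} = {}" by blast
  then show ?thesis by (simp only: num_avoiders_start_def card.empty)
qed

lemma num_avoiders_start_descent:
  assumes "n \<ge> 3" "1 \<le> j" "j < i" "i \<le> n"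
  shows "num_avoiders_start n i j = (\<Sum>k=1..i-1. num_avoiders_start (n-1) j k)"
proof -
  have "{k \<in> {1..n-1}. k < i \<or> i \<le> j \<and> j < k} = {1..i-1}"
    using assms by auto
  then show ?thesis
    using num_avoiders_start_recurrence[of "n-1" i j] assms by (simp add: skip_def)
qed

lemma num_avoiders_start_ascent:
  assumes "n \<ge> 3" "1 \<le> i" "i < j" "j \<le> n"
  shows "num_avoiders_start n i j =
         (\<Sum>k=1..i-1. num_avoiders_start (n-1) (j-1) k) +
         (\<Sum>k=j..n-1. num_avoiders_start (n-1) (j-1) k)"
proof -
  have "{k \<in> {1..n-1}. k < i \<or> i \<le> j-1 \<and> j-1 < k} = {1..i-1} \<union> {j..n-1}"
    using assms by auto
  moreover have "{1..i-1} \<inter> {j..n-1} = {}" "skip i (j-1) = j"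
    using assms by (auto simp: skip_def)
  ultimately show ?thesis
    using num_avoiders_start_recurrence[of "n-1" i "j-1"] assms
    by (simp add: sum.union_disjoint)
qed

lemma avoiders_2: "avoiders 2 = {[1, 2], [2, 1]}"
proof -
  have "permutations_of_set {1..2::nat} = {[1, 2], [2, 1]}"
    by (simp add: atLeastAtMost_insertL[symmetric] numeral_2_eq_2 permutations_of_set_doubleton)
  moreover have "\<not> contains_pattern [x, y] p" if "length p = 3" for x y p
    using that sublist_length_le[of _ "[x, y]"]
    by (fastforce simp: contains_pattern_def order_isomorphic_def)
  ultimately show ?thesis by (auto simp: avoiders_def)
qed

theorem proposition2:
  shows "(\<forall>n\<ge>2. num_avoiders n = (\<Sum>i=1..n. \<Sum>j=1..n. num_avoiders_start n i j)) \<and>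
    (\<forall>n\<ge>2. \<forall>i\<in>{1..n}. num_avoiders_start n i i = 0) \<and>
    (\<forall>n\<ge>3. \<forall>i j. 1 \<le> j \<and> j < i \<and> i \<le> n \<longrightarrow>
       num_avoiders_start n i j = (\<Sum>k=1..i-1. num_avoiders_start (n-1) j k)) \<and>
    (\<forall>n\<ge>3. \<forall>i j. 1 \<le> i \<and> i < j \<and> j \<le> n \<longrightarrow>
       num_avoiders_start n i j =
         (\<Sum>k=1..i-1. num_avoiders_start (n-1) (j-1) k) +
         (\<Sum>k=j..n-1. num_avoiders_start (n-1) (j-1) k)) \<and>
    num_avoiders_start 2 1 2 = 1 \<and> num_avoiders_start 2 2 1 = 1 \<and>
    num_avoiders_start 2 1 1 = 0 \<and> num_avoiders_start 2 2 2 = 0"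
proof (intro conjI allI ballI impI; (elim conjE)?)
  have "{w \<in> avoiders 2. w ! 0 = 1 \<and> w ! 1 = 2} = {[1, 2]}"
       "{w \<in> avoiders 2. w ! 0 = 2 \<and> w ! 1 = 1} = {[2, 1]}"
    unfolding avoiders_2 by auto
  then show "num_avoiders_start 2 1 2 = 1" "num_avoiders_start 2 2 1 = 1"
    by (simp_all add: num_avoiders_start_def)
qed (rule num_avoiders_eq_sum num_avoiders_start_diagonal num_avoiders_start_descent
       num_avoiders_start_ascent; simp)+

end
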